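(* For every integer $t\ge 1$, there exist Meyniel extremal families all of whose graphs are regular and have clique number and chromatic number at least $t$.
   Context: All graphs are finite, simple, undirected and connected. Let $I$ be an infinite set of positive integers. A family of graphs $\{G_n\}_{n\in I}$ with $G_n$ of order $n$ is Meyniel extremal if there is a constant $d>0$ with $c(G_n)\ge d\sqrt n$ for all $n\in I$, where $c$ denotes the cop number. Cops and Robbers on a graph $G$: in round $0$ the cops choose vertices to occupy, then the robber chooses a vertex. In each later round the cops move first and then the robber. On a move, each player moves to a neighboring vertex or stays put; any subset of the cops may move. Both sides have complete information. The cops win if after finitely many rounds some cop occupies the robber's vertex; otherwise the robber wins. The cop number $c(G)$ is the minimum number of cops that guarantees a win for the cops. *)

theory Defs
  imports Complex_Main "Graph_Theory.Digraph_Component"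
begin

(* A finite simple undirected graph is a loopless symmetric digraph (locale pair_graph):
   an undirected edge uv is represented by the two arcs (u,v) and (v,u). *)
definition connected_graph :: "'a pair_pre_digraph \<Rightarrow> bool" where
  "connected_graph G \<longleftrightarrow> pair_graph G \<and> Digraph_Component.connected (with_proj G)"

definition order :: "'a pair_pre_digraph \<Rightarrow> nat" where
  "order G = card (pverts G)"

(* By symmetry of the arc set, the out-degree of a vertex is its number of neighbours. *)
definition regular_graph :: "'a pair_pre_digraph \<Rightarrow> bool" where
  "regular_graph G \<longleftrightarrow> (\<exists>d. \<forall>v\<in>pverts G. out_degree (with_proj G) v = d)"

definition clique :: "'a pair_pre_digraph \<Rightarrow> 'a set \<Rightarrow> bool" where
  "clique G C \<longleftrightarrow> C \<subseteq> pverts G \<and> (\<forall>u\<in>C. \<forall>v\<in>C. u \<noteq> v \<longrightarrow> (u, v) \<in> parcs G)"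

definition clique_number :: "'a pair_pre_digraph \<Rightarrow> nat" where
  "clique_number G = Max (card ` {C. clique G C})"

definition proper_colouring :: "'a pair_pre_digraph \<Rightarrow> nat \<Rightarrow> ('a \<Rightarrow> nat) \<Rightarrow> bool" where
  "proper_colouring G k f \<longleftrightarrow>
     (\<forall>v\<in>pverts G. f v < k) \<and> (\<forall>(u, v)\<in>parcs G. f u \<noteq> f v)"

definition chromatic_number :: "'a pair_pre_digraph \<Rightarrow> nat" where
  "chromatic_number G = (LEAST k. \<exists>f. proper_colouring G k f)"

definition move :: "'a pair_pre_digraph \<Rightarrow> 'a \<Rightarrow> 'a \<Rightarrow> bool" where
  "move G u v \<longleftrightarrow> u = v \<or> (u, v) \<in> parcs G"

(* r m is the robber's vertex at the end of round m. *)
definition robber_play :: "'a pair_pre_digraph \<Rightarrow> (nat \<Rightarrow> 'a) \<Rightarrow> bool" where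
  "robber_play G r \<longleftrightarrow> r 0 \<in> pverts G \<and> (\<forall>m. move G (r m) (r (Suc m)))"

(* A strategy s of the cops maps the robber's past positions to the positions of the cops,
   which are numbered 0, 1, ...: s [] is the placement in round 0, made before the robber
   appears, and the cops' reply in round m is computed from r 0, ..., r (m - 1). *)
definition cops_at :: "('a list \<Rightarrow> nat \<Rightarrow> 'a) \<Rightarrow> (nat \<Rightarrow> 'a) \<Rightarrow> nat \<Rightarrow> nat \<Rightarrow> 'a" where
  "cops_at s r m = s (map r [0..<m])"

(* Play formally continues after a capture; this is harmless, as all players may stay put. *)
definition cop_strategy ::
    "'a pair_pre_digraph \<Rightarrow> nat \<Rightarrow> ('a list \<Rightarrow> nat \<Rightarrow> 'a) \<Rightarrow> bool" where
  "cop_strategy G k s \<longleftrightarrow>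
     (\<forall>i<k. s [] i \<in> pverts G) \<and>
     (\<forall>r. robber_play G r \<longrightarrow>
        (\<forall>m. \<forall>i<k. move G (cops_at s r m i) (cops_at s r (Suc m) i)))"

(* The robber is caught at the end of round m, or by the cops' move in round m + 1. *)
definition captured :: "nat \<Rightarrow> ('a list \<Rightarrow> nat \<Rightarrow> 'a) \<Rightarrow> (nat \<Rightarrow> 'a) \<Rightarrow> bool" where
  "captured k s r \<longleftrightarrow>
     (\<exists>m. \<exists>i<k. cops_at s r m i = r m \<or> cops_at s r (Suc m) i = r m)"

(* Quantifying over all robber plays covers every robber strategy with complete information,
   since s is fixed and deterministic. *)
definition cops_win :: "'a pair_pre_digraph \<Rightarrow> nat \<Rightarrow> bool" where
  "cops_win G k \<longleftrightarrow>
     (\<exists>s. cop_strategy G k s \<and> (\<forall>r. robber_play G r \<longrightarrow> captured k s r))"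

definition cop_number :: "'a pair_pre_digraph \<Rightarrow> nat" where
  "cop_number G = (LEAST k. cops_win G k)"

definition graph_family :: "nat set \<Rightarrow> (nat \<Rightarrow> 'a pair_pre_digraph) \<Rightarrow> bool" where
  "graph_family I G \<longleftrightarrow>
     infinite I \<and> (\<forall>n\<in>I. 0 < n \<and> connected_graph (G n) \<and> order (G n) = n)"

definition meyniel_extremal :: "nat set \<Rightarrow> (nat \<Rightarrow> 'a pair_pre_digraph) \<Rightarrow> bool" where
  "meyniel_extremal I G \<longleftrightarrow> graph_family I G \<and>
     (\<exists>d::real. d > 0 \<and> (\<forall>n\<in>I. real (cop_number (G n)) \<ge> d * sqrt (real n)))"

end

theory Submission
  imports Defs "HOL-Number_Theory.Cong"
begin

text \<open>
  The family is built from the incidence graphs of affine planes over the integers modulo a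
  prime \<open>p\<close>, with one parallel class of lines removed. Such a graph has \<open>2 p\<^sup>2\<close> vertices, is
  \<open>p\<close>-regular and connected, and has girth at least 5: it is bipartite, and two distinct points
  lie on at most one common line. In a graph of girth at least 5 a cop standing anywhere but on
  the robber's vertex guards at most one neighbour of that vertex, so fewer cops than the
  minimum degree always leave the robber an unguarded neighbour to run to
  (\<open>few_cops_lose\<close>). Hence the cop number is at least \<open>p\<close>, which is of the order of the square
  root of the number of vertices.

  These graphs have no triangles. To create large cliques, every vertex is blown up to a
  clique of \<open>t\<close> twins, and twins of adjacent vertices are joined. Regularity and connectedness
  survive, a single fibre is a clique of size \<open>t\<close> (which also forces \<open>t\<close> colours), and the order
  grows only by the constant factor \<open>t\<close>. The cop number does not drop: projecting a winning
  strategy for the blow-up, played against a robber who uses one fixed twin of each vertex,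
  gives a winning strategy for the original graph (\<open>cops_win_blowupD\<close>). So the blow-up has
  order \<open>n = 2 p\<^sup>2 t\<close> and cop number at least \<open>p = sqrt n / sqrt (2 t)\<close>, and
  \<open>1 / sqrt (2 t)\<close> serves as Meyniel constant for all primes \<open>p\<close> at once.
\<close>

section \<open>Symmetric loopless digraphs as graphs\<close>

text \<open>
  For a symmetric arc set the library's connectedness, stated through a symmetrised digraph and
  reachability inside the vertex set, is plain reachability along arcs. In this form it can be
  carried over to blow-ups arc by arc.
\<close>

lemma connected_graph_iff:
  "connected_graph G \<longleftrightarrow>
     pair_graph G \<and> pverts G \<noteq> {} \<and> (\<forall>u\<in>pverts G. \<forall>v\<in>pverts G. (u, v) \<in> (parcs G)\<^sup>*)"
proof (cases "pair_graph G")
  case True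
  interpret pair_graph G by (rule True)
  have arcs: "parcs (mk_symmetric (with_proj G)) = parcs G"
    using pair_sym_arcs by (rule adj_mk_symmetric_eq)
  have reach: "(u, v) \<in> rtrancl_on (pverts G) (parcs G) \<longleftrightarrow> (u, v) \<in> (parcs G)\<^sup>*"
    if "u \<in> pverts G" for u v
  proof
    assume "(u, v) \<in> rtrancl_on (pverts G) (parcs G)"
    then show "(u, v) \<in> (parcs G)\<^sup>*"
      by induction (auto intro: rtrancl_into_rtrancl)
  next
    assume "(u, v) \<in> (parcs G)\<^sup>*"
    then show "(u, v) \<in> rtrancl_on (pverts G) (parcs G)"
      by induction (use that in \<open>auto intro: rtrancl_on_into_rtrancl_on in_arcsD2\<close>)
  qed
  show ?thesis
    unfolding connected_graph_def connected_def strongly_connected_def reachable_def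
    using True reach arcs by simp
qed (simp add: connected_graph_def)

lemma pair_graphI:
  assumes "finite (pverts G)" "parcs G \<subseteq> pverts G \<times> pverts G" "sym (parcs G)"
    "\<And>v. (v, v) \<notin> parcs G"
  shows "pair_graph G"
proof
  show "finite (parcs G)"
    using assms(1,2) by (meson finite_SigmaI finite_subset)
  show "symmetric (with_proj G)"
    using assms(3) by (simp add: symmetric_def)
qed (use assms in \<open>auto simp: subset_iff\<close>)

lemma (in pair_graph) move_in_verts: "move G u v \<Longrightarrow> u \<in> pverts G \<Longrightarrow> v \<in> pverts G"
  by (auto simp: move_def dest: in_arcsD2)

lemma (in pair_graph) move_sym: "move G u v \<longleftrightarrow> move G v u"
  using pair_sym_arcs by (auto simp: move_def symmetric_def elim: symE)

section \<open>Cliques and colourings\<close>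

lemma (in pair_graph) card_clique_le_clique_number:
  assumes "clique G C"
  shows "card C \<le> clique_number G"
proof -
  have "{C. clique G C} \<subseteq> Pow (pverts G)"
    by (auto simp: clique_def)
  then have "finite {C. clique G C}"
    using pair_finite_verts by (meson finite_Pow_iff finite_subset)
  then show ?thesis
    unfolding clique_number_def using assms by (intro Max_ge) auto
qed

lemma (in pair_graph) card_clique_le_chromatic_number:
  assumes C: "clique G C"
  shows "card C \<le> chromatic_number G"
proof -
  obtain f where f: "bij_betw f (pverts G) {0..<card (pverts G)}"
    using ex_bij_betw_finite_nat[OF pair_finite_verts] by blast
  have "f u \<noteq> f v" if "(u, v) \<in> parcs G" for u v
    using f that pair_no_loops[OF that] in_arcsD1[OF that] in_arcsD2[OF that]
    by (auto simp: bij_betw_def inj_on_def)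
  then have "proper_colouring G (card (pverts G)) f"
    using f by (auto simp: proper_colouring_def bij_betw_def)
  then have "\<exists>g. proper_colouring G (chromatic_number G) g"
    unfolding chromatic_number_def by (intro LeastI) blast
  then obtain g where g: "proper_colouring G (chromatic_number G) g" ..
  have "inj_on g C"
    using g C unfolding proper_colouring_def clique_def inj_on_def by fastforce
  moreover have "g ` C \<subseteq> {..<chromatic_number G}"
    using g C unfolding proper_colouring_def clique_def by auto
  ultimately have "card C \<le> card {..<chromatic_number G}"
    by (meson card_inj_on_le finite_lessThan)
  then show ?thesis
    by simp
qed

section \<open>Evading few cops\<close>

text \<open>
  The cop number is a least element, so lower bounds on it mean something only once some number
  of cops is known to win; here a cop stands on every vertex and never moves.
\<close>

lemma (in pair_graph) cops_win_card_verts: "cops_win G (card (pverts G))"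
proof -
  obtain e :: "nat \<Rightarrow> 'a" where e: "bij_betw e {0..<card (pverts G)} (pverts G)"
    using ex_bij_betw_nat_finite[OF pair_finite_verts] by blast
  have "cop_strategy G (card (pverts G)) (\<lambda>_. e)"
    using e by (auto simp: cop_strategy_def cops_at_def move_def bij_betw_def)
  moreover have "captured (card (pverts G)) (\<lambda>_. e) r" if "robber_play G r" for r
  proof -
    have "r 0 \<in> e ` {0..<card (pverts G)}"
      using that e by (simp add: robber_play_def bij_betw_def)
    then obtain i where "i < card (pverts G)" "e i = r 0"
      by auto
    then show ?thesis
      unfolding captured_def cops_at_def by blast
  qed
  ultimately show ?thesis
    unfolding cops_win_def by blast
qed

lemma (in pair_graph) cop_number_geI:
  assumes "\<And>k. k < D \<Longrightarrow> \<not> cops_win G k"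
  shows "D \<le> cop_number G"
proof -
  have "cops_win G (cop_number G)"
    unfolding cop_number_def using cops_win_card_verts by (rule LeastI)
  then show ?thesis
    using assms not_le by blast
qed

text \<open>
  Pigeonhole: if every neighbour of \<open>v\<close> were guarded, sending each to a cop guarding it
  would be injective, because no cop away from \<open>v\<close> guards two of them.
\<close>

lemma (in pair_graph) safe_neighbour:
  assumes dom: "\<And>c w w'. \<lbrakk>c \<noteq> v; (v, w) \<in> parcs G; (v, w') \<in> parcs G; move G c w; move G c w'\<rbrakk>
                 \<Longrightarrow> w = w'"
    and deg: "k < card {w. (v, w) \<in> parcs G}"
    and cops: "\<And>i. i < k \<Longrightarrow> c i \<noteq> v"
  shows "\<exists>w. (v, w) \<in> parcs G \<and> (\<forall>i<k. \<not> move G (c i) w)"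
proof (rule ccontr)
  assume "\<not> ?thesis"
  then obtain g where g: "\<And>w. (v, w) \<in> parcs G \<Longrightarrow> g w < k \<and> move G (c (g w)) w"
    by metis
  have "inj_on g {w. (v, w) \<in> parcs G}"
    using g dom cops by (intro inj_onI) (metis mem_Collect_eq)
  moreover have "g ` {w. (v, w) \<in> parcs G} \<subseteq> {..<k}"
    using g by auto
  ultimately have "card {w. (v, w) \<in> parcs G} \<le> card {..<k}"
    by (meson card_inj_on_le finite_lessThan)
  then show False
    using deg by simp
qed

text \<open>
  The second hypothesis holds exactly in graphs of girth at least 5: a cop on a neighbour \<open>w\<close> of
  \<open>v\<close> who also guards \<open>w'\<close> gives a triangle, and any other cop guarding both gives a 4-cycle.
  The invariant of the play is that, after each robber move, no cop can reach the robber's vertex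
  in one move. Hence the cops' next move does not end the game, and \<open>safe_neighbour\<close> provides
  the vertex that restores the invariant.
\<close>

lemma (in pair_graph) few_cops_lose:
  assumes ne: "pverts G \<noteq> {}"
    and dom: "\<And>v c w w'. \<lbrakk>c \<noteq> v; (v, w) \<in> parcs G; (v, w') \<in> parcs G; move G c w; move G c w'\<rbrakk>
                 \<Longrightarrow> w = w'"
    and deg: "\<And>v. v \<in> pverts G \<Longrightarrow> k < card {w. (v, w) \<in> parcs G}"
  shows "\<not> cops_win G k"
proof
  assume "cops_win G k"
  then obtain s where s: "cop_strategy G k s" and win: "\<And>r. robber_play G r \<Longrightarrow> captured k s r"
    unfolding cops_win_def by blast
  define safe where "safe c w \<longleftrightarrow> (\<forall>i<k. \<not> move G (c i) w)" for c :: "nat \<Rightarrow> 'a" and w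
  have escape: "\<exists>w. (v, w) \<in> parcs G \<and> safe c w" if "v \<in> pverts G" "\<And>i. i < k \<Longrightarrow> c i \<noteq> v" for v c
    unfolding safe_def using dom deg[OF that(1)] that(2) by (rule safe_neighbour)
  \<comment> \<open>Staying put when no neighbour is safe makes the play legal against any cops, and
    the cops' moves are only known to be legal once the robber's whole play is.\<close>
  define f where "f v c = (if \<exists>w. (v, w) \<in> parcs G \<and> safe c w
                           then SOME w. (v, w) \<in> parcs G \<and> safe c w else v)" for v c
  have f_move: "move G v (f v c)" for v c
    using someI_ex[of "\<lambda>w. (v, w) \<in> parcs G \<and> safe c w"] unfolding f_def move_def by auto
  have f_safe: "safe c (f v c)" if "v \<in> pverts G" "\<And>i. i < k \<Longrightarrow> c i \<noteq> v" for v c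
    using escape[of v c] that someI_ex[of "\<lambda>w. (v, w) \<in> parcs G \<and> safe c w"]
    unfolding f_def by auto
  obtain u where "u \<in> pverts G"
    using ne by blast
  \<comment> \<open>The robber's start is found as the escape from an imaginary position on a vertex \<open>v\<close>
    that no cop occupies initially.\<close>
  have "card {w. (u, w) \<in> parcs G} \<le> card (pverts G)"
    by (intro card_mono) (auto simp: pair_finite_verts dest: in_arcsD2)
  then have "k < card (pverts G)"
    using deg[OF \<open>u \<in> pverts G\<close>] by simp
  moreover have "card (s [] ` {..<k}) \<le> k"
    using card_image_le[of "{..<k}" "s []"] by simp
  ultimately have "\<not> pverts G \<subseteq> s [] ` {..<k}"
    by (metis card_mono finite_imageI finite_lessThan leD le_less_trans)
  then obtain v where v: "v \<in> pverts G" "\<And>i. i < k \<Longrightarrow> s [] i \<noteq> v"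
    by blast
  \<comment> \<open>The cops' reply depends on the whole history, so the recursion builds the history \<open>h m\<close>
    and the robber's position \<open>r m\<close> is its last entry.\<close>
  define h where "h = rec_nat [f v (s [])] (\<lambda>_ xs. xs @ [f (last xs) (s xs)])"
  define r where "r m = last (h m)" for m
  have h_Suc: "h (Suc m) = h m @ [f (r m) (s (h m))]" for m
    by (simp add: h_def r_def)
  have r_0: "r 0 = f v (s [])" and r_Suc: "r (Suc m) = f (r m) (s (h m))" for m
    by (simp_all add: r_def h_Suc) (simp add: h_def)
  have h_eq: "h m = map r [0..<Suc m]" for m
  proof (induction m)
    case 0
    show ?case by (simp add: r_0) (simp add: h_def)
  next
    case (Suc m)
    then show ?case by (simp add: h_Suc r_Suc)
  qed
  have r_Suc: "r (Suc m) = f (r m) (cops_at s r (Suc m))" for m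
    by (simp only: r_Suc cops_at_def h_eq)
  have play: "robber_play G r"
    unfolding robber_play_def r_0 r_Suc using f_move move_in_verts v(1) by blast
  have in_verts: "r m \<in> pverts G" for m
    by (induction m) (use play move_in_verts in \<open>auto simp: robber_play_def\<close>)
  have cops_move: "move G (cops_at s r m i) (cops_at s r (Suc m) i)" if "i < k" for m i
    using s play that unfolding cop_strategy_def by blast
  have safe: "safe (cops_at s r m) (r m)" for m
  proof (induction m)
    case 0
    show ?case unfolding r_0 using f_safe[OF v] by (simp add: cops_at_def)
  next
    case (Suc m)
    have "cops_at s r (Suc m) i \<noteq> r m" if "i < k" for i
      using Suc cops_move[OF that, of m] that unfolding safe_def by metis
    then show ?case
      unfolding r_Suc using f_safe in_verts by blast
  qed
  have "cops_at s r m i \<noteq> r m \<and> cops_at s r (Suc m) i \<noteq> r m" if "i < k" for m i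
    using safe[of m] cops_move[OF that, of m] that unfolding safe_def by (metis move_def)
  then have "\<not> captured k s r"
    unfolding captured_def by blast
  then show False
    using win play by blast
qed

section \<open>Clique blow-ups\<close>

text \<open>
  The map \<open>\<pi>\<close> sends a new vertex to the old vertex it is a copy of. Using \<^const>\<open>move\<close>, which
  allows staying put, joins distinct copies of the same vertex as well as copies of
  adjacent vertices. Taking the new vertex set as a parameter lets it be an initial segment of
  the naturals directly.
\<close>

definition clique_blowup :: "'a pair_pre_digraph \<Rightarrow> ('b \<Rightarrow> 'a) \<Rightarrow> 'b set \<Rightarrow> 'b pair_pre_digraph" where
  "clique_blowup G \<pi> N =
     \<lparr>pverts = N, parcs = {(i, j). i \<in> N \<and> j \<in> N \<and> i \<noteq> j \<and> move G (\<pi> i) (\<pi> j)}\<rparr>"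

lemma pverts_clique_blowup [simp]: "pverts (clique_blowup G \<pi> N) = N"
  and parcs_clique_blowup [simp]:
    "(i, j) \<in> parcs (clique_blowup G \<pi> N) \<longleftrightarrow> i \<in> N \<and> j \<in> N \<and> i \<noteq> j \<and> move G (\<pi> i) (\<pi> j)"
  by (simp_all add: clique_blowup_def)

lemma move_clique_blowup:
  "move (clique_blowup G \<pi> N) i j \<longleftrightarrow> i = j \<or> i \<in> N \<and> j \<in> N \<and> move G (\<pi> i) (\<pi> j)"
  by (auto simp: move_def)

locale blowup = pair_graph G for G :: "'a pair_pre_digraph" +
  fixes \<pi> :: "'b \<Rightarrow> 'a" and N :: "'b set" and t :: nat
  assumes finite_N: "finite N"
    and proj: "\<pi> ` N \<subseteq> pverts G"
    and fibre: "\<And>x. x \<in> pverts G \<Longrightarrow> card {i \<in> N. \<pi> i = x} = t"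
    and t_pos: "t > 0"
begin

abbreviation "H \<equiv> clique_blowup G \<pi> N"

lemma pair_graph_blowup: "pair_graph H"
  using finite_N by (intro pair_graphI) (auto intro!: symI simp: move_sym)

lemma ex_section: "\<exists>\<sigma>. \<forall>x\<in>pverts G. \<sigma> x \<in> N \<and> \<pi> (\<sigma> x) = x"
proof -
  have "\<exists>i. i \<in> N \<and> \<pi> i = x" if "x \<in> pverts G" for x
    using fibre[OF that] t_pos by (metis (mono_tags, lifting) card_gt_0_iff empty_Collect_eq)
  then show ?thesis
    by metis
qed

text \<open>
  Walks lift arc by arc to walks between prescribed copies of their ends. Even the trivial walk
  can lift to an arc, namely between two copies of one vertex.
\<close>

lemma connected_blowup:
  assumes "connected_graph G"
  shows "connected_graph H"
proof -
  obtain \<sigma> where \<sigma>: "\<And>x. x \<in> pverts G \<Longrightarrow> \<sigma> x \<in> N \<and> \<pi> (\<sigma> x) = x"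
    using ex_section by blast
  have adj: "(i, j) \<in> (parcs H)\<^sup>*" if "i \<in> N" "j \<in> N" "move G (\<pi> i) (\<pi> j)" for i j
    using that by (cases "i = j") auto
  have lift: "\<forall>j\<in>N. \<pi> j = y \<longrightarrow> (i, j) \<in> (parcs H)\<^sup>*"
    if "(x, y) \<in> (parcs G)\<^sup>*" "i \<in> N" "\<pi> i = x" for i x y
    using that(1)
  proof induction
    case base
    then show ?case using that adj by (simp add: move_def)
  next
    case (step y z)
    show ?case
    proof (intro ballI impI)
      fix j assume "j \<in> N" "\<pi> j = z"
      have y: "\<sigma> y \<in> N" "\<pi> (\<sigma> y) = y"
        using \<sigma> in_arcsD1 step.hyps(2) by blast+
      then have "(\<sigma> y, j) \<in> (parcs H)\<^sup>*"
        using \<open>j \<in> N\<close> \<open>\<pi> j = z\<close> step.hyps(2) by (intro adj) (auto simp: move_def)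
      then show "(i, j) \<in> (parcs H)\<^sup>*"
        using step.IH y by (meson rtrancl_trans)
    qed
  qed
  have "N \<noteq> {}"
    using assms \<sigma> by (fastforce simp: connected_graph_iff)
  moreover have "(i, j) \<in> (parcs H)\<^sup>*" if "i \<in> N" "j \<in> N" for i j
    using assms lift[of "\<pi> i" "\<pi> j" i] proj that by (auto simp: connected_graph_iff)
  ultimately show ?thesis
    using pair_graph_blowup by (simp add: connected_graph_iff)
qed

text \<open>
  A copy of \<open>x\<close> sees the fibres over the \<open>D + 1\<close> vertices of the closed neighbourhood of \<open>x\<close>,
  each of size \<open>t\<close>, except itself.
\<close>

lemma regular_blowup:
  assumes deg: "\<And>x. x \<in> pverts G \<Longrightarrow> card {y. (x, y) \<in> parcs G} = D"
  shows "regular_graph H"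
  unfolding regular_graph_def
proof (intro exI ballI)
  fix i assume "i \<in> pverts H"
  then have i: "i \<in> N" "\<pi> i \<in> pverts G"
    using proj by auto
  let ?B = "insert (\<pi> i) {y. (\<pi> i, y) \<in> parcs G}"
  let ?S = "{j \<in> N. move G (\<pi> i) (\<pi> j)}"
  have fin: "finite {y. (\<pi> i, y) \<in> parcs G}"
    by (rule finite_subset[OF _ pair_finite_verts]) (auto dest: in_arcsD2)
  have "card ?B = D + 1"
    using fin deg[OF i(2)] pair_no_loops[of "(\<pi> i, \<pi> i)"] by (subst card_insert_disjoint) auto
  have "?S = (\<Union>y\<in>?B. {j \<in> N. \<pi> j = y})"
    by (auto simp: move_def)
  also have "card \<dots> = (\<Sum>y\<in>?B. card {j \<in> N. \<pi> j = y})"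
    using fin finite_N by (intro card_UN_disjoint) auto
  also have "\<dots> = (\<Sum>y\<in>?B. t)"
    using i(2) by (intro sum.cong fibre) (auto dest: in_arcsD2)
  finally have "card ?S = (D + 1) * t"
    using \<open>card ?B = D + 1\<close> by simp
  moreover have "out_arcs (with_proj H) i = Pair i ` (?S - {i})"
    using i(1) by (auto simp: out_arcs_def)
  ultimately show "out_degree (with_proj H) i = (D + 1) * t - 1"
    using i(1) finite_N unfolding out_degree_def
    by (simp add: card_image inj_on_def move_def)
qed

lemma clique_fibre: "clique H {i \<in> N. \<pi> i = x}"
  by (auto simp: clique_def move_def)

text \<open>
  A robber in \<open>G\<close> is mirrored by a robber in the blow-up through a section \<open>\<sigma>\<close> of \<open>\<pi>\<close>. The cops
  of the blow-up answer the mirrored play, and \<open>\<pi>\<close> brings their moves back to \<open>G\<close>. It maps a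
  capture to a capture because \<open>\<pi> \<circ> \<sigma>\<close> is the identity on the vertices.
\<close>

lemma cops_win_blowupD:
  assumes "cops_win H k"
  shows "cops_win G k"
proof -
  obtain s where s: "cop_strategy H k s" and win: "\<And>r. robber_play H r \<Longrightarrow> captured k s r"
    using assms unfolding cops_win_def by blast
  obtain \<sigma> where \<sigma>: "\<And>x. x \<in> pverts G \<Longrightarrow> \<sigma> x \<in> N \<and> \<pi> (\<sigma> x) = x"
    using ex_section by blast
  define s' where "s' xs i = \<pi> (s (map \<sigma> xs) i)" for xs i
  have at: "cops_at s' r m i = \<pi> (cops_at s (\<sigma> \<circ> r) m i)" for r m i
    by (simp add: cops_at_def s'_def)
  have in_verts: "r m \<in> pverts G" if "robber_play G r" for r m
    by (induction m) (use that move_in_verts in \<open>auto simp: robber_play_def\<close>)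
  have play: "robber_play H (\<sigma> \<circ> r)" if "robber_play G r" for r
    using that \<sigma> in_verts[OF that] by (auto simp: robber_play_def move_clique_blowup)
  have "cop_strategy G k s'"
    unfolding cop_strategy_def
  proof (intro conjI allI impI)
    fix i assume "i < k"
    then show "s' [] i \<in> pverts G"
      using s proj by (auto simp: cop_strategy_def s'_def)
  next
    fix r m i assume "robber_play G r" "i < k"
    then have "move H (cops_at s (\<sigma> \<circ> r) m i) (cops_at s (\<sigma> \<circ> r) (Suc m) i)"
      using s play unfolding cop_strategy_def by blast
    then show "move G (cops_at s' r m i) (cops_at s' r (Suc m) i)"
      unfolding at move_clique_blowup by (auto simp: move_def)
  qed
  moreover have "captured k s' r" if "robber_play G r" for r
    using win[OF play[OF that]] \<sigma>[OF in_verts[OF that]] unfolding captured_def at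
    by (metis comp_apply)
  ultimately show ?thesis
    unfolding cops_win_def by blast
qed

end

section \<open>An incidence graph over the integers modulo a prime\<close>

text \<open>
  The Boolean tells points from lines: the point \<open>(x, y)\<close> lies on the line of slope \<open>x'\<close> and
  intercept \<open>- y'\<close> iff \<open>x x' = y + y'\<close> modulo \<open>p\<close>. Negating the intercept makes the incidence
  condition symmetric in its two arguments, so that points and lines need not be treated
  separately.
\<close>

definition residue_verts :: "int \<Rightarrow> (bool \<times> int \<times> int) set" where
  "residue_verts p = UNIV \<times> {0..<p} \<times> {0..<p}"

definition incidence_graph :: "int \<Rightarrow> (bool \<times> int \<times> int) pair_pre_digraph" where
  "incidence_graph p =
     \<lparr>pverts = residue_verts p,
      parcs = {((s, x, y), (s', x', y')).
        (s, x, y) \<in> residue_verts p \<and> (s', x', y') \<in> residue_verts p \<and>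
        s' = (\<not> s) \<and> [x * x' = y + y'] (mod p)}\<rparr>"

lemma mem_residue_verts [simp]:
  "(s, x, y) \<in> residue_verts p \<longleftrightarrow> x \<in> {0..<p} \<and> y \<in> {0..<p}"
  by (simp add: residue_verts_def)

lemma pverts_incidence_graph [simp]: "pverts (incidence_graph p) = residue_verts p"
  by (simp add: incidence_graph_def)

lemma parcs_incidence_graph [simp]:
  "((s, x, y), (s', x', y')) \<in> parcs (incidence_graph p) \<longleftrightarrow>
     x \<in> {0..<p} \<and> y \<in> {0..<p} \<and> x' \<in> {0..<p} \<and> y' \<in> {0..<p} \<and>
     s' = (\<not> s) \<and> [x * x' = y + y'] (mod p)"
  by (auto simp: incidence_graph_def)

lemma card_residue_verts: "p \<ge> 0 \<Longrightarrow> card (residue_verts p) = 2 * nat p ^ 2"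
  by (simp add: residue_verts_def card_cartesian_product power2_eq_square)

lemma pair_graph_incidence_graph: "pair_graph (incidence_graph p)"
proof (rule pair_graphI)
  show "finite (pverts (incidence_graph p))"
    by (simp add: residue_verts_def)
qed (auto intro!: symI simp: mult.commute add.commute)

lemma neighbours_incidence_graph:
  assumes "(s, x, y) \<in> residue_verts p"
  shows "{w. ((s, x, y), w) \<in> parcs (incidence_graph p)} = (\<lambda>a. (\<not> s, a, (x * a - y) mod p)) ` {0..<p}"
    (is "?L = ?R")
proof -
  have "b = (x * a - y) mod p" if "b \<in> {0..<p}" "[x * a = y + b] (mod p)" for a b
  proof -
    have "[x * a - y = b] (mod p)"
      using that(2) by (simp add: cong_iff_dvd_diff algebra_simps)
    then show ?thesis
      using that(1) by (simp add: cong_def)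
  qed
  moreover have "[x * a = y + (x * a - y) mod p] (mod p)" for a
    by (simp add: cong_def mod_add_right_eq)
  ultimately show ?thesis
    using assms by (auto simp: image_iff)
qed

lemma degree_incidence_graph:
  assumes "v \<in> residue_verts p"
  shows "card {w. (v, w) \<in> parcs (incidence_graph p)} = nat p"
proof -
  obtain s x y where v: "v = (s, x, y)"
    by (cases v)
  show ?thesis
    using assms unfolding v by (subst neighbours_incidence_graph) (auto simp: card_image inj_on_def)
qed

lemma cong_residue_eq:
  fixes a b p :: int
  assumes "a \<in> {0..<p}" "b \<in> {0..<p}" "[a = b] (mod p)"
  shows "a = b"
  using assms by (simp add: cong_def)

text \<open>
  If \<open>v = (x, y)\<close> and \<open>c = (x1, y1)\<close> have common neighbours \<open>(a, b)\<close> and \<open>(a', b')\<close>, eliminating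
  the second coordinates from the four incidences leaves \<open>(x - x1) (a - a') = 0\<close> modulo \<open>p\<close>. As
  \<open>p\<close> is prime, one factor vanishes, and then the second coordinates agree too.
\<close>

lemma common_neighbour_unique:
  assumes p: "prime p"
    and "v \<noteq> c" "(v, w) \<in> parcs (incidence_graph p)" "(v, w') \<in> parcs (incidence_graph p)"
      "(c, w) \<in> parcs (incidence_graph p)" "(c, w') \<in> parcs (incidence_graph p)"
  shows "w = w'"
proof -
  obtain s x y where v: "v = (s, x, y)" by (cases v)
  obtain s1 x1 y1 where c: "c = (s1, x1, y1)" by (cases c)
  obtain s2 a b where w: "w = (s2, a, b)" by (cases w)
  obtain s3 a' b' where w': "w' = (s3, a', b')" by (cases w')
  note arcs = assms(3-6)[unfolded v c w w' parcs_incidence_graph]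
  have dvd: "p dvd x * a - (y + b)" "p dvd x * a' - (y + b')"
      "p dvd x1 * a - (y1 + b)" "p dvd x1 * a' - (y1 + b')"
    using arcs by (simp_all add: cong_iff_dvd_diff)
  have "p dvd ((x * a - (y + b)) - (x * a' - (y + b'))) - ((x1 * a - (y1 + b)) - (x1 * a' - (y1 + b')))"
    by (rule dvd_diff[OF dvd_diff[OF dvd(1,2)] dvd_diff[OF dvd(3,4)]])
  also have "\<dots> = (x - x1) * (a - a')"
    by (simp add: algebra_simps)
  finally consider "[x = x1] (mod p)" | "[a = a'] (mod p)"
    using p by (auto simp: prime_dvd_mult_iff cong_iff_dvd_diff)
  then show ?thesis
  proof cases
    case 1
    then have "x = x1"
      using arcs by (intro cong_residue_eq) auto
    have "p dvd (x1 * a - (y1 + b)) - (x * a - (y + b))"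
      by (rule dvd_diff[OF dvd(3,1)])
    then have "[y = y1] (mod p)"
      by (simp add: \<open>x = x1\<close> cong_iff_dvd_diff)
    then have "y = y1"
      using arcs by (intro cong_residue_eq) auto
    then show ?thesis
      using \<open>x = x1\<close> \<open>v \<noteq> c\<close> arcs by (simp add: v c)
  next
    case 2
    then have "a = a'"
      using arcs by (intro cong_residue_eq) auto
    have "p dvd (x * a' - (y + b')) - (x * a - (y + b))"
      by (rule dvd_diff[OF dvd(2,1)])
    then have "[b = b'] (mod p)"
      by (simp add: \<open>a = a'\<close> cong_iff_dvd_diff)
    then have "b = b'"
      using arcs by (intro cong_residue_eq) auto
    then show ?thesis
      using \<open>a = a'\<close> arcs by (simp add: w w')
  qed
qed

text \<open>
  When \<open>c\<close> itself is one of the two guarded vertices, it would have to be adjacent to the other,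
  which is impossible because both lie on the same side of the bipartition.
\<close>

lemma dominated_neighbour_unique:
  assumes "prime p" "c \<noteq> v" "(v, w) \<in> parcs (incidence_graph p)" "(v, w') \<in> parcs (incidence_graph p)"
    "move (incidence_graph p) c w" "move (incidence_graph p) c w'"
  shows "w = w'"
proof (cases "(c, w) \<in> parcs (incidence_graph p) \<and> (c, w') \<in> parcs (incidence_graph p)")
  case True
  then show ?thesis
    using assms common_neighbour_unique by metis
next
  case False
  moreover have "(w, w') \<notin> parcs (incidence_graph p)" "(w', w) \<notin> parcs (incidence_graph p)"
    using assms(3,4) by (cases v; cases w; cases w'; auto)+
  ultimately show ?thesis
    using assms(5,6) by (auto simp: move_def)
qed

text \<open>
  The neighbours with first coordinate \<open>0\<close> make connectedness elementary: \<open>(0, - y)\<close> is adjacent to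
  \<open>(x, y)\<close> for every \<open>x\<close>, so the first coordinate can be changed freely. With first coordinate
  \<open>1\<close>, the vertex \<open>(1, y)\<close> is adjacent to \<open>(y, 0)\<close>, which clears the second coordinate.
\<close>

lemma connected_incidence_graph:
  assumes "p > 1"
  shows "connected_graph (incidence_graph p)"
proof -
  let ?R = "(parcs (incidence_graph p))\<^sup>*"
  interpret pair_graph "incidence_graph p"
    by (rule pair_graph_incidence_graph)
  have sym: "(v, u) \<in> ?R" if "(u, v) \<in> ?R" for u v
    using that pair_sym_arcs sym_rtrancl by (auto simp: symmetric_def elim: symE)
  have slide: "((s, x, y), (s, x', y)) \<in> ?R" if "x \<in> {0..<p}" "x' \<in> {0..<p}" "y \<in> {0..<p}" for s x x' y
  proof -
    have "((s, x, y), (\<not> s, 0, (- y) mod p)) \<in> parcs (incidence_graph p)"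
      "((\<not> s, 0, (- y) mod p), (s, x', y)) \<in> parcs (incidence_graph p)"
      using that assms by (auto simp: cong_def mod_add_right_eq mod_add_left_eq)
    then show ?thesis
      by (meson converse_rtrancl_into_rtrancl r_into_rtrancl)
  qed
  have flip: "((s, x, y), (\<not> s, 0, 0)) \<in> ?R" if "x \<in> {0..<p}" "y \<in> {0..<p}" for s x y
  proof -
    have "((s, x, y), (s, 1, y)) \<in> ?R"
      using that assms by (intro slide) auto
    moreover have "((s, 1, y), (\<not> s, y, 0)) \<in> parcs (incidence_graph p)"
      using that assms by auto
    moreover have "((\<not> s, y, 0), (\<not> s, 0, 0)) \<in> ?R"
      using that assms by (intro slide) auto
    ultimately show ?thesis
      by (meson rtrancl_into_rtrancl rtrancl_trans)
  qed
  have root: "(v, (True, 0, 0)) \<in> ?R" if "v \<in> residue_verts p" for v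
  proof -
    obtain s x y where v: "v = (s, x, y)" by (cases v)
    show ?thesis
      using that flip[of x y s] flip[of 0 0 False] assms unfolding v
      by (cases s) (auto intro: rtrancl_trans)
  qed
  have "residue_verts p \<noteq> {}"
    using assms by (auto simp: residue_verts_def)
  then show ?thesis
    unfolding connected_graph_iff using root sym rtrancl_trans pair_graph_axioms
    by (metis pverts_incidence_graph)
qed

section \<open>The extremal family\<close>

lemma ex_projection_equal_fibres:
  assumes "finite V"
  shows "\<exists>\<pi> :: nat \<Rightarrow> 'a. \<pi> ` {..<card V * t} \<subseteq> V \<and>
           (\<forall>x\<in>V. card {i \<in> {..<card V * t}. \<pi> i = x} = t)"
proof -
  have "card (V \<times> {..<t}) = card {..<card V * t}"
    by (simp add: card_cartesian_product)
  then obtain b where b: "bij_betw b {..<card V * t} (V \<times> {..<t})"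
    using assms by (metis finite_SigmaI finite_lessThan finite_same_card_bij)
  have "card {i \<in> {..<card V * t}. fst (b i) = x} = t" if "x \<in> V" for x
  proof -
    have "b ` {i \<in> {..<card V * t}. fst (b i) = x} = {z \<in> b ` {..<card V * t}. fst z = x}"
      by auto
    also have "\<dots> = {x} \<times> {..<t}"
      using b that by (auto simp: bij_betw_def)
    finally have "bij_betw b {i \<in> {..<card V * t}. fst (b i) = x} ({x} \<times> {..<t})"
      using b by (intro bij_betw_subset[OF b]) auto
    then show ?thesis
      by (simp add: bij_betw_same_card)
  qed
  moreover have "(fst \<circ> b) ` {..<card V * t} \<subseteq> V"
    using b unfolding image_comp[symmetric] by (auto simp: bij_betw_def)
  ultimately show ?thesis
    by (intro exI[of _ "fst \<circ> b"]) simp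
qed

lemma ex_blowup_of_incidence_graph:
  assumes p: "prime p" and t: "t > 0"
  shows "\<exists>H :: nat pair_pre_digraph. connected_graph H \<and> order H = 2 * p ^ 2 * t \<and> regular_graph H \<and>
           t \<le> clique_number H \<and> t \<le> chromatic_number H \<and> p \<le> cop_number H"
proof -
  let ?G = "incidence_graph (int p)"
  have p': "prime (int p)" "int p > 1"
    using prime_gt_1_nat[OF p] p by simp_all
  interpret G: pair_graph ?G
    by (rule pair_graph_incidence_graph)
  have ne: "(True, 0, 0) \<in> pverts ?G"
    using p' by simp
  let ?N = "{..<card (pverts ?G) * t}"
  obtain \<pi> where \<pi>: "\<pi> ` ?N \<subseteq> pverts ?G \<and> (\<forall>x\<in>pverts ?G. card {i \<in> ?N. \<pi> i = x} = t)"
    using ex_projection_equal_fibres[OF G.pair_finite_verts] ..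
  interpret blowup ?G \<pi> ?N t
  proof
    show "card {i \<in> ?N. \<pi> i = x} = t" if "x \<in> pverts ?G" for x
      using \<pi> that by (elim conjE bspec)
  qed (use \<pi> t in \<open>simp_all only: finite_lessThan\<close>)
  interpret H: pair_graph H
    by (rule pair_graph_blowup)
  have "connected_graph H"
    using connected_incidence_graph p' by (intro connected_blowup)
  moreover have "order H = 2 * p ^ 2 * t"
    using card_residue_verts[of "int p"] by (simp add: order_def)
  moreover have "regular_graph H"
    using degree_incidence_graph by (intro regular_blowup) auto
  moreover have "t \<le> clique_number H" "t \<le> chromatic_number H"
    using H.card_clique_le_clique_number[OF clique_fibre[of "(True, 0, 0)"]]
      H.card_clique_le_chromatic_number[OF clique_fibre[of "(True, 0, 0)"]] fibre[OF ne] by auto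
  moreover have "p \<le> cop_number H"
  proof (rule H.cop_number_geI)
    fix k assume "k < p"
    have "\<not> cops_win ?G k"
    proof (rule G.few_cops_lose)
      show "pverts ?G \<noteq> {}"
        using ne by blast
      show "k < card {w. (v, w) \<in> parcs ?G}" if "v \<in> pverts ?G" for v
        using that \<open>k < p\<close> by (simp add: degree_incidence_graph)
    qed (rule dominated_neighbour_unique[OF p'(1)])
    then show "\<not> cops_win H k"
      using cops_win_blowupD by blast
  qed
  ultimately show ?thesis
    by blast
qed

theorem corollary22:
  fixes t :: nat
  assumes "t \<ge> 1"
  shows "\<exists>(I :: nat set) (G :: nat \<Rightarrow> nat pair_pre_digraph).
           meyniel_extremal I G \<and>
           (\<forall>n\<in>I. regular_graph (G n) \<and> clique_number (G n) \<ge> t \<and> chromatic_number (G n) \<ge> t)"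
proof -
  define I where "I = (\<lambda>p. 2 * p ^ 2 * t) ` {p :: nat. prime p}"
  have "inj_on (\<lambda>p. 2 * p ^ 2 * t) {p :: nat. prime p}"
    using assms by (auto simp: inj_on_def)
  then have "infinite I"
    unfolding I_def using primes_infinite finite_imageD by blast
  have "\<forall>n\<in>I. \<exists>H :: nat pair_pre_digraph. connected_graph H \<and> order H = n \<and> regular_graph H \<and>
      t \<le> clique_number H \<and> t \<le> chromatic_number H \<and>
      1 / sqrt (2 * real t) * sqrt (real n) \<le> real (cop_number H)"
  proof
    fix n assume "n \<in> I"
    then obtain p where p: "prime p" "n = 2 * p ^ 2 * t"
      by (auto simp: I_def)
    obtain H :: "nat pair_pre_digraph" where H: "connected_graph H" "order H = n" "regular_graph H"
      "t \<le> clique_number H" "t \<le> chromatic_number H" "p \<le> cop_number H"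
      using ex_blowup_of_incidence_graph[OF p(1), of t] assms p(2) by auto
    have "real n = (2 * real t) * real p ^ 2"
      by (simp add: p(2))
    then have "sqrt (real n) = sqrt (2 * real t) * real p"
      by (simp add: real_sqrt_mult)
    then have "1 / sqrt (2 * real t) * sqrt (real n) = real p"
      using assms by simp
    then show "\<exists>H :: nat pair_pre_digraph. connected_graph H \<and> order H = n \<and> regular_graph H \<and>
        t \<le> clique_number H \<and> t \<le> chromatic_number H \<and>
        1 / sqrt (2 * real t) * sqrt (real n) \<le> real (cop_number H)"
      using H by auto
  qed
  then obtain G :: "nat \<Rightarrow> nat pair_pre_digraph" where G:
    "\<forall>n\<in>I. connected_graph (G n) \<and> order (G n) = n \<and> regular_graph (G n) \<and>
      t \<le> clique_number (G n) \<and> t \<le> chromatic_number (G n) \<and>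
      1 / sqrt (2 * real t) * sqrt (real n) \<le> real (cop_number (G n))"
    by metis
  have "0 < n" if "n \<in> I" for n
    using that assms by (auto simp: I_def prime_gt_0_nat)
  moreover have "1 / sqrt (2 * real t) > 0"
    using assms by simp
  ultimately have "meyniel_extremal I G"
    unfolding meyniel_extremal_def graph_family_def using G \<open>infinite I\<close> by blast
  then show ?thesis
    using G by blast
qed

end
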